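(* Let $(X,d)$ be a complete metric space and let $n\ge1$ be an integer. Let $(\mathbb{S}_j)_{j\ge1}$ be a sequence of hyperbolic iterated function systems $\mathbb{S}_j=\{X;f_{1_j},f_{2_j},\dots,f_{n_j}\}$ on $X$ with $n$ contractions which is minimally ordered, eventually decreasing, and Cauchy with respect to $\mathcal{D}$. Then $(\mathbb{S}_j)_{j\ge1}$ is convergent in $(\mathcal{S}_X^n,\mathcal{D})$, i.e. there exists $\mathbb{S}\in\mathcal{S}_X^n$ with $\mathcal{D}(\mathbb{S}_j,\mathbb{S})\to0$ as $j\to\infty$.
   Context: A contraction on $X$ is a map $f:X\to X$ having a contractivity factor $c_f\in[0,1)$, i.e. a constant with $d(f(x),f(y))\le c_f\,d(x,y)$ for all $x,y\in X$; each contraction $f$ is considered together with its contractivity factor $c_f$. A (hyperbolic) iterated function system on $X$ with $n$ contractions, written $\{X;f_1,\dots,f_n\}$, consists of the complete metric space $X$ and $n$ contractions $f_1,\dots,f_n$ on $X$; $\mathcal{S}_X^n$ denotes the collection of all of them. For functions $f,g:X\to X$ put $$\bar{d}_\infty(f,g)=\sup_{x\in X}\frac{d(f(x),g(x))}{1+d(f(x),g(x))},$$ and for $\mathbb{S}=\{X;f_1,\dots,f_n\}$, $\mathbb{T}=\{X;g_1,\dots,g_n\}$ in $\mathcal{S}_X^n$ put $$\mathcal{D}(\mathbb{S},\mathbb{T})=\min_{\sigma\in S_n}\sum_{i=1}^{n}\bar{d}_\infty(f_i,g_{\sigma(i)}),$$ where $S_n$ is the group of permutations of $\{1,\dots,n\}$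 ($\mathcal{D}$ does not depend on the order in which the contractions are listed, and systems differing only by a reordering are identified when $\mathcal{D}$ is viewed as a metric). The following notions refer to the given listings of the contractions. $\mathbb{T}=\{X;g_1,\dots,g_n\}$ is minimally ordered with respect to $\mathbb{S}=\{X;f_1,\dots,f_n\}$ if $\sum_{i=1}^n\bar{d}_\infty(f_i,g_i)=\min_{\sigma\in S_n}\sum_{i=1}^n\bar{d}_\infty(f_i,g_{\sigma(i)})$. If $\mathbb{T}$ is minimally ordered with respect to $\mathbb{S}$, one writes $\mathbb{S}\le\mathbb{T}$ if $c_{f_i}\le c_{g_i}$ for every $i=1,\dots,n$. A sequence $(\mathbb{S}_j)_{j\ge1}$ in $\mathcal{S}_X^n$ is: minimally ordered if $\mathbb{S}_{j+1}$ is minimally ordered with respect to $\mathbb{S}_j$ for every $j\ge1$; eventually decreasing if there exists $k\in\mathbb{N}$ such that $\mathbb{S}_{j+1}\le\mathbb{S}_j$ for every $j\ge k$; Cauchy if for every $\epsilon>0$ there exists $N\in\mathbb{N}$ such that $\mathcal{D}(\mathbb{S}_j,\mathbb{S}_k)<\epsilon$ for all $j,k\ge N$. *)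

theory Defs
  imports "HOL-Analysis.Analysis" "HOL-Combinatorics.Permutations"
begin

text \<open>
  A contraction is carried together with its contractivity factor, as a pair; a listed iterated
  function system is the list of its contractions, so the contractions numbered 1 to n
  sit at the list positions 0 to n - 1.  The space X is the whole type.
\<close>

type_synonym 'a ifs = "(('a \<Rightarrow> 'a) \<times> real) list"

definition contraction :: "('a::metric_space \<Rightarrow> 'a) \<Rightarrow> real \<Rightarrow> bool" where
  "contraction f c \<longleftrightarrow> c \<in> {0..<1} \<and> c-lipschitz_on UNIV f"

definition hyperbolic_ifs :: "nat \<Rightarrow> 'a::metric_space ifs set" where
  "hyperbolic_ifs n = {S. length S = n \<and> (\<forall>(f, c) \<in> set S. contraction f c)}"

abbreviation ifs_map :: "'a ifs \<Rightarrow> nat \<Rightarrow> 'a \<Rightarrow> 'a" where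
  "ifs_map S i \<equiv> fst (S ! i)"

abbreviation ifs_factor :: "'a ifs \<Rightarrow> nat \<Rightarrow> real" where
  "ifs_factor S i \<equiv> snd (S ! i)"

definition dbar :: "('a::metric_space \<Rightarrow> 'a) \<Rightarrow> ('a \<Rightarrow> 'a) \<Rightarrow> real" where
  "dbar f g = (SUP x. dist (f x) (g x) / (1 + dist (f x) (g x)))"

text \<open>
  On lists this is only a pseudometric: reorderings of a system are at distance 0 from it, and
  the factors do not enter.
\<close>

definition ifs_dist :: "nat \<Rightarrow> 'a::metric_space ifs \<Rightarrow> 'a ifs \<Rightarrow> real" where
  "ifs_dist n S T =
     Min ((\<lambda>\<sigma>. \<Sum>i<n. dbar (ifs_map S i) (ifs_map T (\<sigma> i))) ` {\<sigma>. \<sigma> permutes {..<n}})"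

definition minimally_ordered_wrt :: "nat \<Rightarrow> 'a::metric_space ifs \<Rightarrow> 'a ifs \<Rightarrow> bool" where
  "minimally_ordered_wrt n T S \<longleftrightarrow>
     (\<Sum>i<n. dbar (ifs_map S i) (ifs_map T i)) =
     Min ((\<lambda>\<sigma>. \<Sum>i<n. dbar (ifs_map S i) (ifs_map T (\<sigma> i))) ` {\<sigma>. \<sigma> permutes {..<n}})"

definition ifs_le :: "nat \<Rightarrow> 'a::metric_space ifs \<Rightarrow> 'a ifs \<Rightarrow> bool" where
  "ifs_le n S T \<longleftrightarrow>
     minimally_ordered_wrt n T S \<and> (\<forall>i<n. ifs_factor S i \<le> ifs_factor T i)"

text \<open>
  Sequences are indexed from 1; the value at 0 is irrelevant.
\<close>

definition minimally_ordered_seq :: "nat \<Rightarrow> (nat \<Rightarrow> 'a::metric_space ifs) \<Rightarrow> bool" where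
  "minimally_ordered_seq n S \<longleftrightarrow> (\<forall>j\<ge>1. minimally_ordered_wrt n (S (Suc j)) (S j))"

definition eventually_decreasing :: "nat \<Rightarrow> (nat \<Rightarrow> 'a::metric_space ifs) \<Rightarrow> bool" where
  "eventually_decreasing n S \<longleftrightarrow> (\<exists>k\<ge>1. \<forall>j\<ge>k. ifs_le n (S (Suc j)) (S j))"

definition ifs_Cauchy :: "nat \<Rightarrow> (nat \<Rightarrow> 'a::metric_space ifs) \<Rightarrow> bool" where
  "ifs_Cauchy n S \<longleftrightarrow> (\<forall>\<epsilon>>0. \<exists>N\<ge>1. \<forall>j\<ge>N. \<forall>k\<ge>N. ifs_dist n (S j) (S k) < \<epsilon>)"

end

theory Submission
  imports Defs
begin

text \<open>
  The space of maps on a complete space is complete for uniform convergence; what can fail for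
  contractions is only that the factors may tend to 1.  From the index \<open>k\<close> at which the
  sequence starts to decrease, however, all factors are bounded by the largest factor \<open>c < 1\<close> of
  \<open>S k\<close>.  This bound does not depend on the position in the list, so it survives any relabelling
  of the maps, and it is all that is needed (\<open>ifs_Cauchy_imp_convergent\<close>).

  To find the limit, choose indices \<open>r m\<close> beyond which the mutual \<open>ifs_dist\<close> is less than
  \<open>(1/2) ^ Suc m\<close>, and compose the optimal permutations between consecutive systems
  \<open>S (r m)\<close>, \<open>S (r (Suc m))\<close> into relabellings \<open>\<tau> m\<close>.  After relabelling, the sequence of maps at
  each position has summable steps in \<open>dbar\<close>, hence converges uniformly
  (\<open>dbar_summable_steps_limit\<close>), and its limit is \<open>c\<close>-Lipschitz.  The system \<open>T\<close> of these limits,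
  each with factor \<open>c\<close>, is the limit along \<open>r\<close>, and the triangle inequality for \<open>ifs_dist\<close> extends
  this to the whole Cauchy sequence.
\<close>

section \<open>The bounded uniform distance\<close>

lemma ratio_mono:
  fixes s t :: real
  assumes "0 \<le> s" "s \<le> t"
  shows "s / (1 + s) \<le> t / (1 + t)"
  using assms by (simp add: divide_simps) (simp add: algebra_simps)

lemma ratio_subadditive:
  fixes s t :: real
  assumes "0 \<le> s" "0 \<le> t"
  shows "(s + t) / (1 + (s + t)) \<le> s / (1 + s) + t / (1 + t)"
proof -
  have "s / (1 + (s + t)) \<le> s / (1 + s)" "t / (1 + (s + t)) \<le> t / (1 + t)"
    using assms by (auto intro!: divide_left_mono)
  then show ?thesis by (simp add: add_divide_distrib)
qed

lemma ratio_le_self: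
  fixes t :: real
  assumes "0 \<le> t"
  shows "t / (1 + t) \<le> t"
  using assms by (simp add: divide_simps) (simp add: algebra_simps)

lemma ratio_le_half_imp_le:
  fixes t a :: real
  assumes "0 \<le> t" "t / (1 + t) \<le> a" "a \<le> 1 / 2"
  shows "t \<le> 2 * a"
proof -
  have le: "t \<le> a * (1 + t)"
    using assms by (simp add: divide_simps split: if_splits)
  moreover have "a * t \<le> 1 / 2 * t"
    using assms by (intro mult_right_mono) auto
  ultimately show ?thesis by (simp add: distrib_left)
qed

lemma dbar_upper: "dist (f x) (g x) / (1 + dist (f x) (g x)) \<le> dbar f g"
  unfolding dbar_def
proof (rule cSUP_upper)
  have "dist (f x) (g x) / (1 + dist (f x) (g x)) \<le> 1" for x
    by (simp add: divide_le_eq add_nonneg_nonneg not_less)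
  then show "bdd_above (range (\<lambda>x. dist (f x) (g x) / (1 + dist (f x) (g x))))"
    by (rule bdd_aboveI2)
qed simp

lemma dbar_least:
  assumes "\<And>x. dist (f x) (g x) / (1 + dist (f x) (g x)) \<le> M"
  shows "dbar f g \<le> M"
  unfolding dbar_def using assms by (intro cSUP_least) auto

lemma dbar_nonneg: "0 \<le> dbar f g"
  by (rule order_trans[OF _ dbar_upper[where x = undefined]]) simp

lemma dbar_triangle: "dbar f h \<le> dbar f g + dbar g h"
proof (rule dbar_least)
  fix x
  let ?s = "dist (f x) (g x)" and ?t = "dist (g x) (h x)"
  have "dist (f x) (h x) / (1 + dist (f x) (h x)) \<le> (?s + ?t) / (1 + (?s + ?t))"
    by (intro ratio_mono dist_triangle) simp
  also have "\<dots> \<le> ?s / (1 + ?s) + ?t / (1 + ?t)"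
    by (rule ratio_subadditive) auto
  also have "\<dots> \<le> dbar f g + dbar g h"
    by (intro add_mono dbar_upper)
  finally show "dist (f x) (h x) / (1 + dist (f x) (h x)) \<le> dbar f g + dbar g h" .
qed

section \<open>Uniform limits of sequences with geometric steps\<close>

lemma geometric_steps_limit:
  fixes x :: "nat \<Rightarrow> 'a::complete_space"
  assumes step: "\<And>m. dist (x m) (x (Suc m)) \<le> (1 / 2) ^ m"
  obtains L where "x \<longlonglongrightarrow> L" "\<And>m. dist (x m) L \<le> 2 * (1 / 2) ^ m"
proof -
  have "dist (x m) (x (m + p)) \<le> 2 * (1 / 2) ^ m - 2 * (1 / 2) ^ (m + p)" for m p
  proof (induction p)
    case (Suc p)
    have "dist (x m) (x (m + Suc p)) \<le> dist (x m) (x (m + p)) + dist (x (m + p)) (x (Suc (m + p)))"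
      using dist_triangle by (metis add_Suc_right)
    with Suc step[of "m + p"] show ?case by simp
  qed simp
  then have bound: "dist (x m) (x (m + p)) \<le> 2 * (1 / 2) ^ m" for m p
    by (smt (verit) zero_less_power divide_pos_pos)
  have "Cauchy x"
  proof (rule metric_CauchyI)
    fix e :: real
    assume "0 < e"
    then obtain M where M: "(1 / 2) ^ M < e / 4"
      using real_arch_pow_inv[of "e / 4" "1 / 2"] by auto
    have "dist (x a) (x b) < e" if "M \<le> a" "M \<le> b" for a b
      using bound[of M "a - M"] bound[of M "b - M"] that M dist_triangle3[of "x a" "x b" "x M"]
      by simp
    then show "\<exists>M. \<forall>a\<ge>M. \<forall>b\<ge>M. dist (x a) (x b) < e" by blast
  qed
  then obtain L where L: "x \<longlonglongrightarrow> L"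
    using Cauchy_convergent convergent_def by blast
  moreover have "dist (x m) L \<le> 2 * (1 / 2) ^ m" for m
  proof (rule LIMSEQ_le_const2)
    show "(\<lambda>p. dist (x m) (x (p + m))) \<longlonglongrightarrow> dist (x m) L"
      using L by (intro tendsto_intros LIMSEQ_ignore_initial_segment)
  qed (use bound[of m] in \<open>auto simp: add.commute\<close>)
  ultimately show ?thesis using that by blast
qed

lemma dbar_summable_steps_limit:
  fixes h :: "nat \<Rightarrow> 'a \<Rightarrow> 'a::complete_space"
  assumes step: "\<And>m. dbar (h m) (h (Suc m)) \<le> (1 / 2) ^ Suc m"
  shows "\<exists>g. (\<forall>x. (\<lambda>m. h m x) \<longlonglongrightarrow> g x) \<and> (\<forall>m. dbar (h m) g \<le> 2 * (1 / 2) ^ m)"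
proof -
  have "dist (h m x) (h (Suc m) x) \<le> (1 / 2) ^ m" for m x
  proof -
    have "dist (h m x) (h (Suc m) x) \<le> 2 * (1 / 2) ^ Suc m"
    proof (rule ratio_le_half_imp_le)
      show "dist (h m x) (h (Suc m) x) / (1 + dist (h m x) (h (Suc m) x)) \<le> (1 / 2) ^ Suc m"
        by (rule order_trans[OF dbar_upper step])
      show "(1 / 2) ^ Suc m \<le> (1 / 2 :: real)"
        by (simp add: power_le_one)
    qed simp
    then show ?thesis by simp
  qed
  then have "\<exists>L. (\<lambda>m. h m x) \<longlonglongrightarrow> L \<and> (\<forall>m. dist (h m x) L \<le> 2 * (1 / 2) ^ m)" for x
    using geometric_steps_limit[of "\<lambda>m. h m x"] by metis
  then obtain g where g: "\<And>x. (\<lambda>m. h m x) \<longlonglongrightarrow> g x"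
    "\<And>x m. dist (h m x) (g x) \<le> 2 * (1 / 2) ^ m"
    by metis
  have "dbar (h m) g \<le> 2 * (1 / 2) ^ m" for m
    by (rule dbar_least, rule order_trans[OF ratio_le_self g(2)]) simp
  with g(1) show ?thesis by blast
qed

lemma lipschitz_on_pointwise_limit:
  assumes lip: "\<And>m. c-lipschitz_on A (h m)"
    and lim: "\<And>x. x \<in> A \<Longrightarrow> (\<lambda>m. h m x) \<longlonglongrightarrow> g x"
  shows "c-lipschitz_on A g"
proof (rule lipschitz_onI)
  fix x y
  assume "x \<in> A" "y \<in> A"
  then show "dist (g x) (g y) \<le> c * dist x y"
    by (intro LIMSEQ_le_const2[OF tendsto_dist[OF lim lim]]) (auto intro: lipschitz_onD[OF lip])
qed (use lip lipschitz_on_nonneg in blast)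

section \<open>The distance between iterated function systems\<close>

lemma ifs_dist_le:
  assumes "\<sigma> permutes {..<n}"
  shows "ifs_dist n S T \<le> (\<Sum>i<n. dbar (ifs_map S i) (ifs_map T (\<sigma> i)))"
  unfolding ifs_dist_def using assms by (intro Min_le) (auto simp: finite_permutations)

lemma ifs_dist_attained:
  "\<exists>\<sigma>. \<sigma> permutes {..<n} \<and> ifs_dist n S T = (\<Sum>i<n. dbar (ifs_map S i) (ifs_map T (\<sigma> i)))"
proof -
  let ?A = "{\<sigma>. \<sigma> permutes {..<n}}"
  have "?A \<noteq> {}" using permutes_id[of "{..<n}"] by blast
  then have "ifs_dist n S T \<in> (\<lambda>\<sigma>. \<Sum>i<n. dbar (ifs_map S i) (ifs_map T (\<sigma> i))) ` ?A"
    unfolding ifs_dist_def by (intro Min_in) (auto simp: finite_permutations)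
  then show ?thesis by auto
qed

lemma ifs_dist_nonneg: "0 \<le> ifs_dist n S T"
proof -
  obtain \<sigma> where "ifs_dist n S T = (\<Sum>i<n. dbar (ifs_map S i) (ifs_map T (\<sigma> i)))"
    using ifs_dist_attained by blast
  then show ?thesis by (simp add: sum_nonneg dbar_nonneg)
qed

lemma ifs_dist_triangle: "ifs_dist n S U \<le> ifs_dist n S T + ifs_dist n T U"
proof -
  obtain \<sigma> where \<sigma>: "\<sigma> permutes {..<n}"
    "ifs_dist n S T = (\<Sum>i<n. dbar (ifs_map S i) (ifs_map T (\<sigma> i)))"
    using ifs_dist_attained by blast
  obtain \<tau> where \<tau>: "\<tau> permutes {..<n}"
    "ifs_dist n T U = (\<Sum>i<n. dbar (ifs_map T i) (ifs_map U (\<tau> i)))"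
    using ifs_dist_attained by blast
  have "ifs_dist n S U \<le> (\<Sum>i<n. dbar (ifs_map S i) (ifs_map U ((\<tau> \<circ> \<sigma>) i)))"
    by (intro ifs_dist_le permutes_compose \<sigma>(1) \<tau>(1))
  also have "\<dots> \<le> (\<Sum>i<n. dbar (ifs_map S i) (ifs_map T (\<sigma> i))
      + dbar (ifs_map T (\<sigma> i)) (ifs_map U (\<tau> (\<sigma> i))))"
    by (intro sum_mono) (simp add: dbar_triangle)
  also have "\<dots> = ifs_dist n S T + (\<Sum>i<n. dbar (ifs_map T (\<sigma> i)) (ifs_map U (\<tau> (\<sigma> i))))"
    by (simp add: sum.distrib \<sigma>(2))
  also have "(\<Sum>i<n. dbar (ifs_map T (\<sigma> i)) (ifs_map U (\<tau> (\<sigma> i)))) = ifs_dist n T U"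
    unfolding \<tau>(2)
    using sum.permute[OF \<sigma>(1), of "\<lambda>i. dbar (ifs_map T i) (ifs_map U (\<tau> i))"]
    by (simp add: o_def)
  finally show ?thesis .
qed

text \<open>
  Consecutive optimal matchings compose: the \<open>i\<close>-th map of the first system is followed through
  the sequence by the position \<open>\<tau> m i\<close>.
\<close>

lemma ifs_aligned_listings:
  assumes step: "\<And>m. ifs_dist n (R m) (R (Suc m)) \<le> \<epsilon> m"
  obtains \<tau> where "\<And>m. \<tau> m permutes {..<n}"
    "\<And>m i. i < n \<Longrightarrow> dbar (ifs_map (R m) (\<tau> m i)) (ifs_map (R (Suc m)) (\<tau> (Suc m) i)) \<le> \<epsilon> m"
proof -
  have "\<forall>m. \<exists>\<sigma>. \<sigma> permutes {..<n} \<and> ifs_dist n (R m) (R (Suc m)) =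
      (\<Sum>i<n. dbar (ifs_map (R m) i) (ifs_map (R (Suc m)) (\<sigma> i)))"
    using ifs_dist_attained by blast
  from choice[OF this] obtain \<sigma> where \<sigma>: "\<And>m. \<sigma> m permutes {..<n}"
    "\<And>m. ifs_dist n (R m) (R (Suc m)) =
      (\<Sum>i<n. dbar (ifs_map (R m) i) (ifs_map (R (Suc m)) (\<sigma> m i)))"
    by blast
  define \<tau> where "\<tau> = rec_nat id (\<lambda>m t. \<sigma> m \<circ> t)"
  have \<tau>0: "\<tau> 0 = id" and \<tau>Suc: "\<tau> (Suc m) = \<sigma> m \<circ> \<tau> m" for m
    by (simp_all add: \<tau>_def)
  have perm: "\<tau> m permutes {..<n}" for m
    by (induction m) (simp_all only: \<tau>0 \<tau>Suc permutes_id permutes_compose \<sigma>(1))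
  have "dbar (ifs_map (R m) (\<tau> m i)) (ifs_map (R (Suc m)) (\<tau> (Suc m) i)) \<le> \<epsilon> m"
    if "i < n" for m i
  proof -
    have "\<tau> m i \<in> {..<n}"
      using permutes_in_image[OF perm] that by simp
    then have "dbar (ifs_map (R m) (\<tau> m i)) (ifs_map (R (Suc m)) (\<sigma> m (\<tau> m i)))
        \<le> ifs_dist n (R m) (R (Suc m))"
      unfolding \<sigma>(2)
      by (intro member_le_sum[of "\<tau> m i" _ "\<lambda>i. dbar (ifs_map (R m) i) (ifs_map (R (Suc m)) (\<sigma> m i))"])
        (auto simp: dbar_nonneg)
    with step[of m] show ?thesis by (simp add: \<tau>Suc)
  qed
  with perm show ?thesis using that by blast
qed

section \<open>Convergence under a uniform bound on the factors\<close>

text \<open>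
  Only the Lipschitz constants of the maps matter here; the factors listed with them do not
  enter.
\<close>

lemma ifs_Cauchy_imp_convergent:
  fixes S :: "nat \<Rightarrow> 'a::complete_space ifs"
  assumes Cauchy: "ifs_Cauchy n S"
    and lip: "\<And>j i. j \<ge> k \<Longrightarrow> i < n \<Longrightarrow> c-lipschitz_on UNIV (ifs_map (S j) i)"
    and c: "c \<in> {0..<1}"
  shows "\<exists>T \<in> hyperbolic_ifs n. (\<lambda>j. ifs_dist n (S j) T) \<longlonglongrightarrow> 0"
proof -
  have "\<exists>N. \<forall>j\<ge>N. \<forall>l\<ge>N. ifs_dist n (S j) (S l) < (1 / 2) ^ Suc m" for m
    using Cauchy unfolding ifs_Cauchy_def by (meson half_gt_zero_iff zero_less_one zero_less_power)
  then obtain N where N: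
    "\<And>m j l. j \<ge> N m \<Longrightarrow> l \<ge> N m \<Longrightarrow> ifs_dist n (S j) (S l) < (1 / 2) ^ Suc m"
    by metis
  \<comment> \<open>The partial sums make \<open>r\<close> increasing while keeping \<open>r m\<close> beyond both \<open>k\<close> and \<open>N m\<close>.\<close>
  define r where "r m = k + (\<Sum>i\<le>m. N i)" for m
  have rk: "r m \<ge> k" and rN: "r m \<ge> N m" and rSuc: "r (Suc m) \<ge> r m" for m
    using member_le_sum[of m "{..m}" N] by (auto simp: r_def)
  have step: "ifs_dist n (S (r m)) (S (r (Suc m))) \<le> (1 / 2) ^ Suc m" for m
    using N[OF rN order_trans[OF rN rSuc]] by (rule less_imp_le)
  obtain \<tau> where \<tau>: "\<And>m. \<tau> m permutes {..<n}"
    and close: "\<And>m i. i < n \<Longrightarrow>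
      dbar (ifs_map (S (r m)) (\<tau> m i)) (ifs_map (S (r (Suc m))) (\<tau> (Suc m) i)) \<le> (1 / 2) ^ Suc m"
    using ifs_aligned_listings[of n "\<lambda>m. S (r m)", OF step] by blast
  define h where "h i m = ifs_map (S (r m)) (\<tau> m i)" for i m
  have "\<exists>g. (\<forall>x. (\<lambda>m. h i m x) \<longlonglongrightarrow> g x) \<and> (\<forall>m. dbar (h i m) g \<le> 2 * (1 / 2) ^ m)"
    if "i < n" for i
    by (rule dbar_summable_steps_limit) (use close[OF that] in \<open>simp add: h_def\<close>)
  then obtain g where g: "\<And>i x. i < n \<Longrightarrow> (\<lambda>m. h i m x) \<longlonglongrightarrow> g i x"
    "\<And>i m. i < n \<Longrightarrow> dbar (h i m) (g i) \<le> 2 * (1 / 2) ^ m"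
    by metis
  have g_lip: "c-lipschitz_on UNIV (g i)" if "i < n" for i
  proof (rule lipschitz_on_pointwise_limit[of _ _ "h i"])
    fix m
    have "\<tau> m i < n"
      using permutes_in_image[OF \<tau>, of m i] that by simp
    then show "c-lipschitz_on UNIV (h i m)"
      unfolding h_def using lip rk by blast
  qed (use g(1) that in blast)
  define T where "T = map (\<lambda>i. (g i, c)) [0..<n]"
  have T: "T \<in> hyperbolic_ifs n"
    using g_lip c by (auto simp: T_def hyperbolic_ifs_def contraction_def)
  have sub: "ifs_dist n (S (r m)) T \<le> real n * (2 * (1 / 2) ^ m)" for m
  proof -
    have "ifs_dist n (S (r m)) T
        \<le> (\<Sum>i<n. dbar (ifs_map (S (r m)) i) (ifs_map T (inv (\<tau> m) i)))"
      by (intro ifs_dist_le permutes_inv \<tau>)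
    also have "\<dots> = (\<Sum>i<n. dbar (ifs_map (S (r m)) (\<tau> m i)) (ifs_map T i))"
      using sum.permute[OF \<tau>, of "\<lambda>i. dbar (ifs_map (S (r m)) i) (ifs_map T (inv (\<tau> m) i))" m]
      by (simp add: o_def permutes_inverses[OF \<tau>])
    also have "\<dots> \<le> (\<Sum>i<n. 2 * (1 / 2) ^ m)"
      using g(2) by (intro sum_mono) (simp add: T_def h_def)
    finally show ?thesis by simp
  qed
  have tail: "ifs_dist n (S j) T \<le> (1 / 2) ^ Suc m + real n * (2 * (1 / 2) ^ m)"
    if "j \<ge> N m" for j m
    using ifs_dist_triangle[of n "S j" T "S (r m)"] N[OF that rN] sub[of m] by linarith
  have "(\<lambda>m. (1 / 2) ^ Suc m + real n * (2 * (1 / 2) ^ m)) \<longlonglongrightarrow> 0 + real n * (2 * 0)"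
    by (intro tendsto_intros LIMSEQ_Suc LIMSEQ_power_zero) auto
  then have lim: "(\<lambda>m. (1 / 2) ^ Suc m + real n * (2 * (1 / 2) ^ m)) \<longlonglongrightarrow> 0" by simp
  have "(\<lambda>j. ifs_dist n (S j) T) \<longlonglongrightarrow> 0"
  proof (rule LIMSEQ_I)
    fix e :: real
    assume "0 < e"
    then have "\<forall>\<^sub>F m in sequentially. (1 / 2) ^ Suc m + real n * (2 * (1 / 2) ^ m) < e"
      by (rule order_tendstoD(2)[OF lim])
    then obtain m where m: "(1 / 2) ^ Suc m + real n * (2 * (1 / 2) ^ m) < e"
      using eventually_happens' sequentially_bot by blast
    have "norm (ifs_dist n (S j) T - 0) < e" if "j \<ge> N m" for j
      using tail[OF that] m ifs_dist_nonneg[of n "S j" T] by simp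
    then show "\<exists>N. \<forall>j\<ge>N. norm (ifs_dist n (S j) T - 0) < e" by blast
  qed
  with T show ?thesis by blast
qed

theorem theorem3p13:
  fixes S :: "nat \<Rightarrow> 'a::complete_space ifs" and n :: nat
  assumes "n \<ge> 1"
    and "\<And>j. j \<ge> 1 \<Longrightarrow> S j \<in> hyperbolic_ifs n"
    and "minimally_ordered_seq n S"
    and "eventually_decreasing n S"
    and "ifs_Cauchy n S"
  shows "\<exists>T \<in> hyperbolic_ifs n. (\<lambda>j. ifs_dist n (S j) T) \<longlonglongrightarrow> 0"
proof -
  obtain k where k: "k \<ge> 1" "\<And>j. j \<ge> k \<Longrightarrow> ifs_le n (S (Suc j)) (S j)"
    using assms(4) unfolding eventually_decreasing_def by blast
  have contr: "contraction (ifs_map (S j) i) (ifs_factor (S j) i)" if "j \<ge> 1" "i < n" for i j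
  proof -
    from assms(2)[OF that(1)] have len: "length (S j) = n"
      and all: "\<And>p. p \<in> set (S j) \<Longrightarrow> contraction (fst p) (snd p)"
      unfolding hyperbolic_ifs_def by (auto simp: case_prod_beta)
    show ?thesis using all[OF nth_mem] len that(2) by simp
  qed
  have factor_le: "ifs_factor (S j) i \<le> ifs_factor (S k) i" if "j \<ge> k" "i < n" for i j
    using that(1)
  proof (induction rule: dec_induct)
    case (step j)
    then show ?case using k(2)[of j] that(2) unfolding ifs_le_def by force
  qed simp
  define c where "c = Max (ifs_factor (S k) ` {..<n})"
  have "{..<n} \<noteq> {}"
    using assms(1) by (auto simp: lessThan_empty_iff)
  then have "c \<in> ifs_factor (S k) ` {..<n}"
    unfolding c_def by (intro Max_in) auto
  then have c: "c \<in> {0..<1}"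
    using contr[OF k(1)] unfolding contraction_def by auto
  have "c-lipschitz_on UNIV (ifs_map (S j) i)" if "j \<ge> k" "i < n" for i j
  proof -
    have "ifs_factor (S j) i \<le> c"
      by (rule order_trans[OF factor_le[OF that]]) (use that in \<open>simp add: c_def\<close>)
    moreover have "(ifs_factor (S j) i)-lipschitz_on UNIV (ifs_map (S j) i)"
      using contr that k(1) unfolding contraction_def by simp
    ultimately show ?thesis using lipschitz_on_le by blast
  qed
  from ifs_Cauchy_imp_convergent[OF assms(5) this c] show ?thesis .
qed

end
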